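(* For every positive integer $t$, let \[ G_t=P_4[\overline{K}_{t},\overline{K}_{16t},\overline{K}_{8t},\overline{K}_{36t}] \qquad\text{and}\qquad H_t=\mathsf{Paw}[\overline{K}_{4t},\overline{K}_{9t},\overline{K}_{16t},\overline{K}_{32t}]. \] Then $G_t$ and $H_t$ are connected and distance cospectral of order $61t$. Moreover, $G_t$ is bipartite, whereas $H_t$ is non-bipartite. Their common distance characteristic polynomial is \[ \chi_{D(G_t)}(\lambda)=\chi_{D(H_t)}(\lambda)=(\lambda+2)^{61t-4}\Bigl((\lambda+2)^4-122t(\lambda+2)^3+1116t^2(\lambda+2)^2+6912t^3(\lambda+2)-55296t^4\Bigr). \]
   Context: All graphs are finite, simple and undirected. The order of a graph is its number of vertices. For a connected graph $X$, the distance matrix is $D(X)=(d_X(u,v))_{u,v\in V(X)}$, where $d_X(u,v)$ is the distance between $u$ and $v$, and the distance characteristic polynomial is $\chi_{D(X)}(\lambda)=\det(\lambda I-D(X))$. The distance spectrum of $X$ is the multiset of eigenvalues of $D(X)$ (with multiplicities); two connected graphs are distance cospectral if they have the same distance spectrum. For a connected graph $F$ with vertex set $\{0,1,\ldots,r-1\}$, $r\ge 2$, and positive integers $m_0,\ldots,m_{r-1}$, the independent-set blow-up $F[\overline{K}_{m_0},\ldots,\overline{K}_{m_{r-1}}]$ is the graph obtained by replacing each vertex $i$ with an independent set $V_i$ of size $m_i$ (the $V_i$ pairwise disjoint) and each edge $ij\in E(F)$ with all edges between $V_i$ and $V_j$ (and no other edges). $P_4$ is the path on vertices $0,1,2,3$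 with edges $01,12,23$. $\mathsf{Paw}$ is the paw graph on vertices $0,1,2,3$ with edges $01,02,03,12$ (a triangle $0,1,2$ with a pendant vertex $3$ attached to $0$). *)

theory Defs
  imports
    "Graph_Theory.Graph_Theory"
    "Jordan_Normal_Form.Char_Poly"
    "HOL-Computational_Algebra.Fundamental_Theorem_Algebra"
begin

text \<open>
  A finite simple undirected graph is a \<^term>\<open>pair_graph\<close> of the Graph Theory library: a finite
  loop-free digraph without parallel arcs whose arc relation is symmetric, so that an undirected
  edge is represented by its two orientations.
\<close>

definition ugraph :: "'a set \<Rightarrow> ('a \<times> 'a) set \<Rightarrow> 'a pair_pre_digraph" where
  "ugraph V E = \<lparr>pverts = V, parcs = E \<union> E\<inverse>\<rparr>"

definition P4 :: "nat pair_pre_digraph" where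
  "P4 = ugraph {0, 1, 2, 3} {(0, 1), (1, 2), (2, 3)}"

definition Paw :: "nat pair_pre_digraph" where
  "Paw = ugraph {0, 1, 2, 3} {(0, 1), (0, 2), (0, 3), (1, 2)}"

text \<open>
  The independent-set blow-up of a graph \<open>F\<close> on the vertices \<open>0, \<dots>, r - 1\<close>, where
  \<open>ms = [m\<^sub>0, \<dots>, m\<^sub>r\<^sub>-\<^sub>1]\<close>; the part \<open>V\<^sub>i\<close> is \<open>{i} \<times> {0, \<dots>, m\<^sub>i - 1}\<close>.
\<close>

definition blowup :: "nat pair_pre_digraph \<Rightarrow> nat list \<Rightarrow> (nat \<times> nat) pair_pre_digraph" where
  "blowup F ms =
     \<lparr>pverts = (SIGMA i : pverts F. {..<ms ! i}),
      parcs = {((i, a), (j, b)) | i a j b. (i, j) \<in> parcs F \<and> a < ms ! i \<and> b < ms ! j}\<rparr>"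

definition bipartite :: "'a pair_pre_digraph \<Rightarrow> bool" where
  "bipartite G \<longleftrightarrow>
     (\<exists>U W. pverts G = U \<union> W \<and> U \<inter> W = {} \<and> parcs G \<subseteq> U \<times> W \<union> W \<times> U)"

text \<open>The distance is meaningful only if \<open>v\<close> is reachable from \<open>u\<close>.\<close>

definition gdist :: "'a pair_pre_digraph \<Rightarrow> 'a \<Rightarrow> 'a \<Rightarrow> nat" where
  "gdist G u v = (LEAST k. \<exists>p. pre_digraph.awalk (with_proj G) u p v \<and> length p = k)"

text \<open>
  Matrices are indexed by natural numbers, so the distance matrix is formed with respect to a list
  of the vertices. The characteristic polynomial does not depend on that list; see
  \<open>distance_char_poly_eq\<close> below.
\<close>

definition distance_matrix :: "'a pair_pre_digraph \<Rightarrow> 'a list \<Rightarrow> real mat" where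
  "distance_matrix G vs =
     mat (length vs) (length vs) (\<lambda>(i, j). real (gdist G (vs ! i) (vs ! j)))"

definition vertex_list :: "'a pair_pre_digraph \<Rightarrow> 'a list" where
  "vertex_list G = (SOME vs. distinct vs \<and> set vs = pverts G)"

definition distance_char_poly :: "'a pair_pre_digraph \<Rightarrow> real poly" where
  "distance_char_poly G = char_poly (distance_matrix G (vertex_list G))"

text \<open>
  All complex roots are collected, so that no eigenvalue is lost by definition (a real symmetric
  matrix has only real ones).
\<close>

definition distance_spectrum :: "'a pair_pre_digraph \<Rightarrow> complex multiset" where
  "distance_spectrum G =
     proots (char_poly (map_mat complex_of_real (distance_matrix G (vertex_list G))))"

definition distance_cospectral :: "'a pair_pre_digraph \<Rightarrow> 'b pair_pre_digraph \<Rightarrow> bool" where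
  "distance_cospectral G H \<longleftrightarrow>
     Digraph_Component.connected (with_proj G) \<and> Digraph_Component.connected (with_proj H) \<and>
     distance_spectrum G = distance_spectrum H"

definition G_graph :: "nat \<Rightarrow> (nat \<times> nat) pair_pre_digraph" where
  "G_graph t = blowup P4 [t, 16 * t, 8 * t, 36 * t]"

definition H_graph :: "nat \<Rightarrow> (nat \<times> nat) pair_pre_digraph" where
  "H_graph t = blowup Paw [4 * t, 9 * t, 16 * t, 32 * t]"


lemma pair_graph_ugraph:
  assumes "finite V" "E \<subseteq> V \<times> V" "\<And>v. (v, v) \<notin> E"
  shows "pair_graph (ugraph V E)"
proof -
  have "finite E" using assms(1,2) by (meson finite_SigmaI finite_subset)
  then show ?thesis
    using assms by unfold_locales (auto simp: ugraph_def symmetric_def sym_def)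
qed

lemma pair_graph_P4: "pair_graph P4"
  unfolding P4_def by (rule pair_graph_ugraph) auto

lemma pair_graph_Paw: "pair_graph Paw"
  unfolding Paw_def by (rule pair_graph_ugraph) auto

lemma pair_graph_blowup:
  assumes "pair_graph F"
  shows "pair_graph (blowup F ms)"
proof -
  interpret pair_graph F by fact
  let ?V = "SIGMA i : pverts F. {..<ms ! i}"
  have fin: "finite ?V" using pair_finite_verts by auto
  have sub: "parcs (blowup F ms) \<subseteq> ?V \<times> ?V"
    using in_arcsD1 in_arcsD2 by (auto simp: blowup_def)
  have "finite (parcs (blowup F ms))" using fin sub by (meson finite_SigmaI finite_subset)
  moreover have "(v, u) \<in> parcs F" if "(u, v) \<in> parcs F" for u v
    using pair_sym_arcs that by (auto simp: symmetric_def dest: symD)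
  ultimately show ?thesis
    using fin sub pair_no_loops
    by unfold_locales (fastforce simp: blowup_def symmetric_def sym_def)+
qed

lemma vertex_list:
  assumes "finite (pverts G)"
  shows "distinct (vertex_list G)" "set (vertex_list G) = pverts G"
  using someI_ex[OF finite_distinct_list[OF assms]]
  by (auto simp: vertex_list_def conj_commute)

lemma char_poly_distance_matrix_perm:
  assumes "distinct vs" "distinct ws" "set vs = set ws"
  shows "char_poly (distance_matrix G vs) = char_poly (distance_matrix G ws)"
proof -
  define n where "n = length vs"
  have n: "length ws = n" using assms by (metis distinct_card n_def)
  have "mset vs = mset ws" using assms set_eq_iff_mset_eq_distinct by blast
  then obtain p where p: "p permutes {..<length vs}" and pw: "permute_list p vs = ws"
    by (metis mset_eq_permutation)
  have pn: "p permutes {0..<n}" using p by (simp add: n_def atLeast0LessThan)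
  have pi: "p i < n" if "i < n" for i using permutes_in_image[OF pn] that by auto
  have wi: "ws ! i = vs ! p i" if "i < n" for i
    using permute_list_nth[OF p] that pw by (auto simp: n_def)
  have inj: "p i = p j \<longleftrightarrow> i = j" for i j using permutes_inj[OF pn] by (auto dest: injD)
  let ?A = "char_poly_matrix (distance_matrix G vs)"
  let ?B = "mat n n (\<lambda>(i, j). ?A $$ (p i, j))"
  let ?C = "char_poly_matrix (distance_matrix G ws)"
  have A: "?A \<in> carrier_mat n n"
    by (auto simp: char_poly_matrix_def distance_matrix_def n_def)
  have "transpose_mat ?C = mat n n (\<lambda>(i, j). transpose_mat ?B $$ (p i, j))"
    by (rule eq_matI)
      (auto simp: char_poly_matrix_def distance_matrix_def n n_def[symmetric] pi wi inj)
  then have "det ?C = signof p * det (transpose_mat ?B)"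
    using det_permute_rows[OF _ pn, of "transpose_mat ?B"] det_transpose[of ?C n]
    by (simp add: char_poly_matrix_def distance_matrix_def n)
  also have "det (transpose_mat ?B) = signof p * det ?A"
    using det_permute_rows[OF A pn] det_transpose[of ?B n] by simp
  finally show ?thesis
    by (simp add: char_poly_def mult.assoc[symmetric] sign_def)
qed

lemma distance_char_poly_eq:
  assumes "distinct vs" "set vs = pverts G"
  shows "distance_char_poly G = char_poly (distance_matrix G vs)"
proof -
  have "finite (pverts G)" using assms(2) by (metis List.finite_set)
  from vertex_list[OF this] assms show ?thesis
    unfolding distance_char_poly_def by (intro char_poly_distance_matrix_perm) auto
qed

end

theory Submission
  imports Defs
begin

text \<open>
  Two vertices of a blow-up of a connected graph \<open>F\<close> with at least two vertices are at distance \<open>2\<close>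
  if they lie in the same part, and at the distance of their parts in \<open>F\<close> otherwise. Hence
  \<open>D + 2 I = S B S\<^sup>T\<close>, where \<open>S\<close> is the incidence matrix of vertices and parts and \<open>B\<close> is the distance
  matrix of \<open>F\<close> with its diagonal replaced by \<open>2\<close>. By Sylvester's determinant identity,
  \<open>det ((\<lambda> + 2) I - S B S\<^sup>T)\<close> is \<open>(\<lambda> + 2)\<close> to the power \<open>n - r\<close> times
  \<open>det ((\<lambda> + 2) I - B S\<^sup>T S)\<close>, and \<open>S\<^sup>T S\<close> is the diagonal matrix of the part sizes. For the two
  graphs at hand the latter \<open>4 \<times> 4\<close> determinants coincide.
\<close>

section \<open>Determinant identities\<close>

text \<open>Laplace expansion along row 0, with each minor written as a \<open>mat\<close> again, so
  that repeated rewriting evaluates a determinant of fixed size.\<close>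

lemma det_mat_Suc:
  fixes f :: "nat \<times> nat \<Rightarrow> 'a :: comm_ring_1"
  shows "det (mat (Suc n) (Suc n) f) =
    (\<Sum>j<Suc n. f (0, j) * ((-1) ^ j *
      det (mat n n (\<lambda>(i, k). f (Suc i, if k < j then k else Suc k)))))"
proof -
  have "mat_delete (mat (Suc n) (Suc n) f) 0 j =
      mat n n (\<lambda>(i, k). f (Suc i, if k < j then k else Suc k))" for j
    by (rule eq_matI) (auto simp: mat_delete_def)
  then show ?thesis
    by (subst laplace_expansion_row[of _ "Suc n" 0]) (auto simp: cofactor_def intro!: sum.cong)
qed

text \<open>The powers of \<open>x\<close> on both sides avoid division: \<open>x\<close> will be a
  polynomial, and \<open>n\<close> and \<open>k\<close> need not be compared.\<close>

lemma det_smult_one_minus_mult_commute: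
  fixes A C :: "'a :: idom mat"
  assumes A: "A \<in> carrier_mat n k" and C: "C \<in> carrier_mat k n"
  shows "x ^ k * det (x \<cdot>\<^sub>m 1\<^sub>m n - A * C) = x ^ n * det (x \<cdot>\<^sub>m 1\<^sub>m k - C * A)"
proof -
  \<comment> \<open>\<open>?L\<close> and \<open>?R\<close> make \<open>?M\<close> block triangular, which gives two expressions for \<open>det ?M\<close>.\<close>
  let ?M = "four_block_mat (x \<cdot>\<^sub>m 1\<^sub>m n) A C (1\<^sub>m k)"
  let ?L = "four_block_mat (1\<^sub>m n) (0\<^sub>m n k) (- C) (1\<^sub>m k)"
  let ?R = "four_block_mat (1\<^sub>m n) (- A) (0\<^sub>m k n) (x \<cdot>\<^sub>m 1\<^sub>m k)"
  have M: "?M \<in> carrier_mat (n + k) (n + k)" using A C by auto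
  have L: "?L \<in> carrier_mat (n + k) (n + k)" using C by auto
  have R: "?R \<in> carrier_mat (n + k) (n + k)" using A by auto
  have AC: "A * C \<in> carrier_mat n n" "C * A \<in> carrier_mat k k" using A C by auto
  have "?M * ?L = four_block_mat ((x \<cdot>\<^sub>m 1\<^sub>m n) * 1\<^sub>m n + A * (- C)) ((x \<cdot>\<^sub>m 1\<^sub>m n) * 0\<^sub>m n k + A * 1\<^sub>m k)
      (C * 1\<^sub>m n + 1\<^sub>m k * (- C)) (C * 0\<^sub>m n k + 1\<^sub>m k * 1\<^sub>m k)"
    by (rule mult_four_block_mat) (use A C in auto)
  also have "\<dots> = four_block_mat (x \<cdot>\<^sub>m 1\<^sub>m n - A * C) A (0\<^sub>m k n) (1\<^sub>m k)"
    using A C AC by (intro cong_four_block_mat) (auto simp: minus_add_uminus_mat)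
  finally have mult_L: "?M * ?L = four_block_mat (x \<cdot>\<^sub>m 1\<^sub>m n - A * C) A (0\<^sub>m k n) (1\<^sub>m k)" .
  have mult_R: "?M * ?R = four_block_mat (x \<cdot>\<^sub>m 1\<^sub>m n) (0\<^sub>m n k) C (x \<cdot>\<^sub>m 1\<^sub>m k - C * A)"
  proof -
    have "?M * ?R = four_block_mat ((x \<cdot>\<^sub>m 1\<^sub>m n) * 1\<^sub>m n + A * 0\<^sub>m k n) ((x \<cdot>\<^sub>m 1\<^sub>m n) * (- A) + A * (x \<cdot>\<^sub>m 1\<^sub>m k))
        (C * 1\<^sub>m n + 1\<^sub>m k * 0\<^sub>m k n) (C * (- A) + 1\<^sub>m k * (x \<cdot>\<^sub>m 1\<^sub>m k))"
      by (rule mult_four_block_mat) (use A C in auto)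
    also have "(x \<cdot>\<^sub>m 1\<^sub>m n) * (- A) + A * (x \<cdot>\<^sub>m 1\<^sub>m k) = 0\<^sub>m n k"
      using A by (auto simp: mult_smult_distrib[of _ n k _ k] mult_smult_assoc_mat[of _ n n _ k])
    also have "C * (- A) + 1\<^sub>m k * (x \<cdot>\<^sub>m 1\<^sub>m k) = x \<cdot>\<^sub>m 1\<^sub>m k - C * A"
      using A C AC by auto
    also have "(x \<cdot>\<^sub>m 1\<^sub>m n) * 1\<^sub>m n + A * 0\<^sub>m k n = x \<cdot>\<^sub>m 1\<^sub>m n"
      using A by simp
    also have "C * 1\<^sub>m n + 1\<^sub>m k * 0\<^sub>m k n = C"
      using C by simp
    finally show ?thesis .
  qed
  have "det ?M * det ?L = det (?M * ?L)"
    by (rule det_mult[OF M L, symmetric])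
  also have "\<dots> = det (x \<cdot>\<^sub>m 1\<^sub>m n - A * C) * det (1\<^sub>m k)"
    unfolding mult_L by (rule det_four_block_mat_lower_left_zero[OF minus_carrier_mat[OF AC(1)] A refl]) simp
  also have "det ?L = det (1\<^sub>m n) * det (1\<^sub>m k)"
    by (rule det_four_block_mat_upper_right_zero[OF _ refl]) (use C in auto)
  finally have det_M: "det ?M = det (x \<cdot>\<^sub>m 1\<^sub>m n - A * C)" by simp
  have "det ?M * det ?R = det (?M * ?R)"
    by (rule det_mult[OF M R, symmetric])
  also have "\<dots> = det (x \<cdot>\<^sub>m 1\<^sub>m n) * det (x \<cdot>\<^sub>m 1\<^sub>m k - C * A)"
    unfolding mult_R by (rule det_four_block_mat_upper_right_zero[OF _ refl C minus_carrier_mat[OF AC(2)]]) simp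
  also have "det ?R = det (1\<^sub>m n) * det (x \<cdot>\<^sub>m 1\<^sub>m k)"
    by (rule det_four_block_mat_lower_left_zero[OF _ _ refl]) (use A in auto)
  finally show ?thesis by (simp add: det_M mult.commute)
qed

lemma char_poly_block_constant:
  fixes b :: "nat \<Rightarrow> nat \<Rightarrow> 'a :: idom"
  assumes f: "\<And>p. p < n \<Longrightarrow> f p < k"
  shows "[:c, 1:] ^ k * char_poly (mat n n (\<lambda>(p, q). b (f p) (f q) - (if p = q then c else 0))) =
    [:c, 1:] ^ n * det (mat k k (\<lambda>(i, j).
      (if i = j then [:c, 1:] else 0) - [:b i j * of_nat (card {p. p < n \<and> f p = j}):]))"
proof -
  \<comment> \<open>\<open>A\<close> plays the role of S and \<open>C\<close> that of B S^T, so
    \<open>A * C\<close> has the entries \<open>b (f p) (f q)\<close>, while \<open>C * A\<close> is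
    B S^T S.\<close>
  define A :: "'a poly mat" where "A = mat n k (\<lambda>(p, i). if f p = i then 1 else 0)"
  define C where "C = mat k n (\<lambda>(i, q). [:b i (f q):])"
  have A: "A \<in> carrier_mat n k" and C: "C \<in> carrier_mat k n" by (auto simp: A_def C_def)
  have "char_poly_matrix (mat n n (\<lambda>(p, q). b (f p) (f q) - (if p = q then c else 0))) =
      [:c, 1:] \<cdot>\<^sub>m 1\<^sub>m n - A * C"
    by (rule eq_matI)
      (auto simp: char_poly_matrix_def A_def C_def scalar_prod_def f if_distrib[of "Polynomial.smult _"]
        cong: if_cong)
  \<comment> \<open>Column j of \<open>A\<close> selects the indices of block j, and each of them
    contributes the same \<open>b i j\<close>.\<close>
  moreover have "(\<Sum>q = 0..<n. [:b i (f q):] * (if f q = j then 1 else 0)) =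
      [:b i j * of_nat (card {p. p < n \<and> f p = j}):]" for i j
  proof -
    have "(\<Sum>q = 0..<n. [:b i (f q):] * (if f q = j then 1 else 0)) =
        (\<Sum>q \<in> {p. p < n \<and> f p = j}. [:b i j:])"
      by (rule sum.mono_neutral_cong_right) auto
    then show ?thesis by (simp add: of_nat_poly mult.commute)
  qed
  then have "[:c, 1:] \<cdot>\<^sub>m 1\<^sub>m k - C * A = mat k k (\<lambda>(i, j).
      (if i = j then [:c, 1:] else 0) - [:b i j * of_nat (card {p. p < n \<and> f p = j}):])"
    by (intro eq_matI) (auto simp: A_def C_def scalar_prod_def)
  ultimately show ?thesis
    using det_smult_one_minus_mult_commute[OF A C, of "[:c, 1:]"] by (simp add: char_poly_def)
qed

section \<open>Distances certified by a potential\<close>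

text \<open>Following arcs that lower \<open>d\<close> by exactly one must end at \<open>v\<close>,
  the only vertex where descent may stop.\<close>

lemma awalk_potential:
  fixes d :: "'a \<Rightarrow> nat"
  assumes "d v = 0"
    and "\<And>u. u \<in> pverts G \<Longrightarrow> u \<noteq> v \<Longrightarrow> \<exists>w \<in> pverts G. (u, w) \<in> parcs G \<and> d u = Suc (d w)"
    and "u \<in> pverts G"
  shows "\<exists>p. pre_digraph.awalk (with_proj G) u p v \<and> length p = d u"
  using assms(3)
proof (induction "d u" arbitrary: u rule: less_induct)
  case less
  show ?case
  proof (cases "u = v")
    case True
    then show ?thesis
      using assms(1) less.prems
      by (intro exI[of _ "[]"]) (simp add: pre_digraph.awalk_def pre_digraph.cas.simps)
  next
    case False
    with assms(2) less.prems obtain w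
      where w: "w \<in> pverts G" "(u, w) \<in> parcs G" "d u = Suc (d w)" by blast
    from less.hyps[OF _ w(1)] w(3) obtain p
      where p: "pre_digraph.awalk (with_proj G) w p v" "length p = d w" by auto
    with w less.prems show ?thesis
      by (intro exI[of _ "(u, w) # p"]) (simp add: pre_digraph.awalk_def pre_digraph.cas.simps)
  qed
qed

text \<open>\<open>down\<close> yields a walk of length \<open>d u\<close>; by \<open>step\<close>,
  \<open>d\<close> drops by at most one per arc, so no walk to \<open>v\<close> is shorter.
  Distances are thus verified by local conditions on \<open>d\<close>.\<close>

lemma gdist_potential:
  fixes d :: "'a \<Rightarrow> nat"
  assumes zero: "d v = 0"
    and down: "\<And>u. u \<in> pverts G \<Longrightarrow> u \<noteq> v \<Longrightarrow>
      \<exists>w \<in> pverts G. (u, w) \<in> parcs G \<and> d u = Suc (d w)"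
    and step: "\<And>u w. (u, w) \<in> parcs G \<Longrightarrow> d u \<le> Suc (d w)"
    and u: "u \<in> pverts G"
  shows "gdist G u v = d u"
proof -
  have "d x \<le> length p" if "pre_digraph.cas (with_proj G) x p v" "set p \<subseteq> parcs G" for x p
    using that
  proof (induction p arbitrary: x)
    case Nil
    then show ?case using zero by (simp add: pre_digraph.cas.simps)
  next
    case (Cons e p)
    then have "d (snd e) \<le> length p" "fst e = x" by (auto simp: pre_digraph.cas.simps)
    with step[of x "snd e"] Cons.prems show ?case by (cases e) auto
  qed
  then show ?thesis
    unfolding gdist_def using awalk_potential[OF zero down u]
    by (intro Least_equality) (auto simp: pre_digraph.awalk_def)
qed

text \<open>Connectedness is strong connectedness of the symmetric closure, to which walks of
  \<open>G\<close> carry over.\<close>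

lemma connected_with_projI:
  assumes "pair_wf_digraph G" "pverts G \<noteq> {}"
    and "\<And>u v. u \<in> pverts G \<Longrightarrow> v \<in> pverts G \<Longrightarrow> \<exists>p. pre_digraph.awalk (with_proj G) u p v"
  shows "Digraph_Component.connected (with_proj G)"
proof -
  interpret pair_wf_digraph G by fact
  show ?thesis
    using assms(2,3)
    by (auto simp: connected_def strongly_connected_def reachable_awalk intro!: reachable_mk_symmetricI)
qed

section \<open>Distances and characteristic polynomials of blow-ups\<close>

text \<open>
  The function \<open>\<delta>\<close> is the distance of \<open>F\<close> off the diagonal, while \<open>\<delta> i i = 2\<close> is the distance
  between two different vertices of the same part.
\<close>

locale blowup_distance =
  fixes F :: "nat pair_pre_digraph" and ms :: "nat list" and \<delta> :: "nat \<Rightarrow> nat \<Rightarrow> nat"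
  assumes F: "pair_graph F"
    and ms_pos: "\<And>i. i \<in> pverts F \<Longrightarrow> 0 < ms ! i"
    and diag: "\<And>i. i \<in> pverts F \<Longrightarrow> \<delta> i i = 2"
    and adj: "\<And>i j. (i, j) \<in> parcs F \<Longrightarrow> \<delta> i j = 1"
    and step: "\<And>i j k. (i, k) \<in> parcs F \<Longrightarrow> j \<in> pverts F \<Longrightarrow> \<delta> i j \<le> Suc (\<delta> k j)"
    and descent: "\<And>i j. i \<in> pverts F \<Longrightarrow> j \<in> pverts F \<Longrightarrow> (i, j) \<notin> parcs F \<Longrightarrow>
      \<exists>k. (i, k) \<in> parcs F \<and> \<delta> i j = Suc (\<delta> k j)"
begin

interpretation F: pair_graph F by (rule F)

text \<open>If the parts of \<open>u\<close> and \<open>v\<close> are adjacent, step to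
  \<open>v\<close> itself; otherwise lift a descent in \<open>F\<close>. The second case includes
  distinct vertices of one part: \<open>F\<close> has no loops, so \<open>descent\<close> applies
  with i = j.\<close>

lemma blowup_descent:
  fixes u v :: "nat \<times> nat"
  assumes "u \<in> pverts (blowup F ms)" "v \<in> pverts (blowup F ms)" "u \<noteq> v"
  shows "\<exists>w \<in> pverts (blowup F ms). (u, w) \<in> parcs (blowup F ms) \<and>
    (if u = v then 0 else \<delta> (fst u) (fst v)) = Suc (if w = v then 0 else \<delta> (fst w) (fst v))"
proof (cases "(fst u, fst v) \<in> parcs F")
  case True
  with assms adj[OF True] show ?thesis
    by (intro bexI[of _ v]) (auto simp: blowup_def)
next
  case False
  have "fst u \<in> pverts F" "fst v \<in> pverts F"
    using assms by (auto simp: blowup_def)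
  from descent[OF this False] obtain k
    where k: "(fst u, k) \<in> parcs F" "\<delta> (fst u) (fst v) = Suc (\<delta> k (fst v))"
    by blast
  from k(1) have "k \<in> pverts F" by (rule F.in_arcsD2)
  \<comment> \<open>Part k is adjacent to the part of \<open>u\<close> and that of \<open>v\<close>
    is not, so the new vertex differs from \<open>v\<close> and its potential is not the exceptional
    value 0.\<close>
  moreover from False k(1) have "(k, 0) \<noteq> v" by auto
  ultimately show ?thesis
    using assms k ms_pos[of k] by (intro bexI[of _ "(k, 0)"]) (auto simp: blowup_def)
qed

lemma gdist_blowup:
  assumes "u \<in> pverts (blowup F ms)" "v \<in> pverts (blowup F ms)"
  shows "gdist (blowup F ms) u v = (if u = v then 0 else \<delta> (fst u) (fst v))"
proof (rule gdist_potential[where d = "\<lambda>u. if u = v then 0 else \<delta> (fst u) (fst v)"])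
  fix x y assume "(x, y) \<in> parcs (blowup F ms)"
  \<comment> \<open>For y = v the bound is \<open>adj\<close>; for x and y both different from
    \<open>v\<close> it is \<open>step\<close> in \<open>F\<close>.\<close>
  then show "(if x = v then 0 else \<delta> (fst x) (fst v)) \<le> Suc (if y = v then 0 else \<delta> (fst y) (fst v))"
    using assms(2) adj step by (auto simp: blowup_def)
qed (use assms blowup_descent in auto)

lemma connected_blowup:
  assumes "i \<in> pverts F"
  shows "Digraph_Component.connected (with_proj (blowup F ms))"
proof (rule connected_with_projI)
  show "pair_wf_digraph (blowup F ms)"
    using pair_graph_blowup[OF F] by (simp add: pair_graph_def pair_digraph_def pair_fin_digraph_def)
  from assms ms_pos show "pverts (blowup F ms) \<noteq> {}" by (auto simp: blowup_def)
  fix u v assume "u \<in> pverts (blowup F ms)" "v \<in> pverts (blowup F ms)"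
  then show "\<exists>p. pre_digraph.awalk (with_proj (blowup F ms)) u p v"
    using awalk_potential[where d = "\<lambda>u. if u = v then 0 else \<delta> (fst u) (fst v)" and G = "blowup F ms" and v = v and u = u]
      blowup_descent by (auto simp del: One_nat_def)
qed

lemma card_blowup: "card (pverts (blowup F ms)) = (\<Sum>i \<in> pverts F. ms ! i)"
  using F.pair_finite_verts by (simp add: blowup_def card_SigmaI)

lemma distance_char_poly_blowup:
  assumes "pverts F = {..<r}"
  shows "[:2, 1:] ^ r * distance_char_poly (blowup F ms) =
    [:2, 1:] ^ (\<Sum>i<r. ms ! i) * det (mat r r (\<lambda>(i, j).
      (if i = j then [:2, 1:] else 0) - [:real (\<delta> i j * ms ! j):]))"
proof -
  define vs where "vs = vertex_list (blowup F ms)"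
  define f where "f p = fst (vs ! p)" for p
  have "finite (pverts (blowup F ms))"
    using F.pair_finite_verts by (simp add: blowup_def)
  then have vs: "distinct vs" "set vs = pverts (blowup F ms)"
    unfolding vs_def by (rule vertex_list)+
  have len: "length vs = (\<Sum>i<r. ms ! i)"
    using distinct_card[OF vs(1)] card_blowup vs(2) assms by simp
  have mem: "vs ! p \<in> pverts (blowup F ms)" if "p < length vs" for p
    using that vs(2) by (metis nth_mem)
  then have f: "f p < r" if "p < length vs" for p
    using that assms by (force simp: f_def blowup_def)
  \<comment> \<open>On the diagonal the distance 0 is \<open>\<delta> i i\<close> - 2, which fixes
    the shift c = 2.\<close>
  have "distance_matrix (blowup F ms) vs =
      mat (length vs) (length vs) (\<lambda>(p, q). real (\<delta> (f p) (f q)) - (if p = q then 2 else 0))"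
    by (rule eq_matI)
      (use mem f assms diag vs(1) in
        \<open>auto simp: distance_matrix_def gdist_blowup f_def nth_eq_iff_index_eq\<close>)
  moreover have "card {p. p < length vs \<and> f p = j} = ms ! j" if "j < r" for j
  proof -
    have "bij_betw (nth vs) {p. p < length vs \<and> f p = j} ({j} \<times> {..<ms ! j})"
    proof (rule bij_betw_imageI)
      show "inj_on (nth vs) {p. p < length vs \<and> f p = j}"
        using inj_on_nth[OF vs(1)] by simp
      have "x \<in> {j} \<times> {..<ms ! j} \<longleftrightarrow> x \<in> set vs \<and> fst x = j" for x
        using assms that by (cases x) (auto simp: vs(2) blowup_def)
      then have "{j} \<times> {..<ms ! j} = {x \<in> set vs. fst x = j}" by blast
      moreover have "nth vs ` {p. p < length vs \<and> f p = j} = {x \<in> set vs. fst x = j}"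
        unfolding f_def set_conv_nth setcompr_eq_image Compr_image_eq by simp
      ultimately show "nth vs ` {p. p < length vs \<and> f p = j} = {j} \<times> {..<ms ! j}"
        by simp
    qed
    then show ?thesis by (auto dest: bij_betw_same_card)
  qed
  then have "mat r r (\<lambda>(i, j). (if i = j then [:2, 1:] else 0)
        - [:real (\<delta> i j) * of_nat (card {p. p < length vs \<and> f p = j}):]) =
      mat r r (\<lambda>(i, j). (if i = j then [:2, 1:] else 0) - [:real (\<delta> i j * ms ! j):])"
    by (intro eq_matI) auto
  ultimately show ?thesis
    using char_poly_block_constant[of "length vs" f r 2 "\<lambda>i j. real (\<delta> i j)"] f
    by (simp add: distance_char_poly_def vs_def[symmetric] len)
qed

end

text \<open>Reduces cospectrality to equality of the real characteristic polynomials, since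
  \<open>complex_of_real\<close> is a ring homomorphism.\<close>

lemma distance_spectrum_eq_proots:
  "distance_spectrum G = proots (map_poly complex_of_real (distance_char_poly G))"
  unfolding distance_spectrum_def distance_char_poly_def
  by (subst of_real_hom.char_poly_hom) (auto simp: distance_matrix_def)


section \<open>The two base graphs\<close>

definition P4_dist :: "nat list list" where
  "P4_dist = [[2, 1, 2, 3], [1, 2, 1, 2], [2, 1, 2, 1], [3, 2, 1, 2]]"

definition Paw_dist :: "nat list list" where
  "Paw_dist = [[2, 1, 1, 1], [1, 2, 1, 2], [1, 1, 2, 2], [1, 2, 2, 2]]"

lemma pverts_P4_Paw: "pverts P4 = {..<4}" "pverts Paw = {..<4}"
  by (auto simp: P4_def Paw_def ugraph_def)

lemma parcs_P4: "parcs P4 = {(0, 1), (1, 2), (2, 3), (1, 0), (2, 1), (3, 2)}"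
  by (auto simp: P4_def ugraph_def)

lemma parcs_Paw: "parcs Paw = {(0, 1), (0, 2), (0, 3), (1, 2), (1, 0), (2, 0), (3, 0), (2, 1)}"
  by (auto simp: Paw_def ugraph_def)

lemma blowup_distance_P4:
  assumes "0 < t"
  shows "blowup_distance P4 [t, 16 * t, 8 * t, 36 * t] (\<lambda>i j. P4_dist ! i ! j)"
proof (rule blowup_distance.intro)
  have verts: "pverts P4 = {0, 1, 2, 3}" by (simp add: P4_def ugraph_def)
  show "pair_graph P4" by (rule pair_graph_P4)
  show "0 < [t, 16 * t, 8 * t, 36 * t] ! i" if "i \<in> pverts P4" for i
    using that assms by (auto simp: verts)
  show "P4_dist ! i ! i = 2" if "i \<in> pverts P4" for i
    using that by (auto simp: verts P4_dist_def)
  show "P4_dist ! i ! j = 1" if "(i, j) \<in> parcs P4" for i j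
    using that by (auto simp: parcs_P4 P4_dist_def)
  have "\<forall>(i, k) \<in> parcs P4. \<forall>j \<in> pverts P4. P4_dist ! i ! j \<le> Suc (P4_dist ! k ! j)"
    by (simp add: verts parcs_P4 P4_dist_def)
  then show "P4_dist ! i ! j \<le> Suc (P4_dist ! k ! j)"
    if "(i, k) \<in> parcs P4" "j \<in> pverts P4" for i j k
    using that by blast
  \<comment> \<open>The witness k is sought among the finitely many arcs, so that every quantifier
    is bounded and simplification decides the claim.\<close>
  have "\<forall>i \<in> pverts P4. \<forall>j \<in> pverts P4. (i, j) \<notin> parcs P4 \<longrightarrow>
      (\<exists>(i', k) \<in> parcs P4. i = i' \<and> P4_dist ! i ! j = Suc (P4_dist ! k ! j))"
    by (simp add: verts parcs_P4 P4_dist_def)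
  then show "\<exists>k. (i, k) \<in> parcs P4 \<and> P4_dist ! i ! j = Suc (P4_dist ! k ! j)"
    if "i \<in> pverts P4" "j \<in> pverts P4" "(i, j) \<notin> parcs P4" for i j
    using that by blast
qed

lemma blowup_distance_Paw:
  assumes "0 < t"
  shows "blowup_distance Paw [4 * t, 9 * t, 16 * t, 32 * t] (\<lambda>i j. Paw_dist ! i ! j)"
proof (rule blowup_distance.intro)
  have verts: "pverts Paw = {0, 1, 2, 3}" by (simp add: Paw_def ugraph_def)
  show "pair_graph Paw" by (rule pair_graph_Paw)
  show "0 < [4 * t, 9 * t, 16 * t, 32 * t] ! i" if "i \<in> pverts Paw" for i
    using that assms by (auto simp: verts)
  show "Paw_dist ! i ! i = 2" if "i \<in> pverts Paw" for i
    using that by (auto simp: verts Paw_dist_def)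
  show "Paw_dist ! i ! j = 1" if "(i, j) \<in> parcs Paw" for i j
    using that by (auto simp: parcs_Paw Paw_dist_def)
  have "\<forall>(i, k) \<in> parcs Paw. \<forall>j \<in> pverts Paw. Paw_dist ! i ! j \<le> Suc (Paw_dist ! k ! j)"
    by (simp add: verts parcs_Paw Paw_dist_def)
  then show "Paw_dist ! i ! j \<le> Suc (Paw_dist ! k ! j)"
    if "(i, k) \<in> parcs Paw" "j \<in> pverts Paw" for i j k
    using that by blast
  have "\<forall>i \<in> pverts Paw. \<forall>j \<in> pverts Paw. (i, j) \<notin> parcs Paw \<longrightarrow>
      (\<exists>(i', k) \<in> parcs Paw. i = i' \<and> Paw_dist ! i ! j = Suc (Paw_dist ! k ! j))"
    by (simp add: verts parcs_Paw Paw_dist_def)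
  then show "\<exists>k. (i, k) \<in> parcs Paw \<and> Paw_dist ! i ! j = Suc (Paw_dist ! k ! j)"
    if "i \<in> pverts Paw" "j \<in> pverts Paw" "(i, j) \<notin> parcs Paw" for i j
    using that by blast
qed

section \<open>The common quartic factor\<close>

text \<open>Here \<open>y\<close> stands for \<lambda> + 2 and \<open>s\<close> for t; the form is
  homogeneous because all part sizes are multiples of t. The general ring allows polynomial
  arguments.\<close>

definition quartic :: "'a :: comm_ring_1 \<Rightarrow> 'a \<Rightarrow> 'a" where
  "quartic s y = y ^ 4 - 122 * s * y ^ 3 + 1116 * s ^ 2 * y ^ 2 + 6912 * s ^ 3 * y - 55296 * s ^ 4"

text \<open>The coefficient of y^(4-k) s^k is (-1)^k times the sum of the principal k by k minors of
  the table, each weighted by the product of its part sizes. For k = 1 this is -2 * 61, for k = 4 it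
  is -12 * 4608.\<close>

lemma det_P4:
  "det (mat 4 4 (\<lambda>(i, j). (if i = j then y else 0)
      - of_nat (P4_dist ! i ! j * [1, 16, 8, 36] ! j) * s)) = quartic s y"
proof -
  have four: "(4::nat) = Suc (Suc (Suc (Suc 0)))" by simp
  show ?thesis
    unfolding four det_mat_Suc
    by (simp add: P4_dist_def)
      (simp add: quartic_def algebra_simps power2_eq_square power3_eq_cube power4_eq_xxxx)
qed

text \<open>The weighted minors of different tables agree in total for these sizes; for k = 4 the
  sum is now -3 * 18432, again -55296. This coincidence makes the graphs cospectral.\<close>

lemma det_Paw:
  "det (mat 4 4 (\<lambda>(i, j). (if i = j then y else 0)
      - of_nat (Paw_dist ! i ! j * [4, 9, 16, 32] ! j) * s)) = quartic s y"
proof -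
  have four: "(4::nat) = Suc (Suc (Suc (Suc 0)))" by simp
  show ?thesis
    unfolding four det_mat_Suc
    by (simp add: Paw_dist_def)
      (simp add: quartic_def algebra_simps power2_eq_square power3_eq_cube power4_eq_xxxx)
qed

text \<open>Pulls the factor t out of the part sizes, leaving the numerical weights of
  \<open>det_P4\<close> and \<open>det_Paw\<close> with s = \<open>[:real t:]\<close>.\<close>

lemma quotient_mat_scale:
  assumes "length ms = r"
  shows "mat r r (\<lambda>(i, j). (if i = j then y else 0) -
      [:real (d i j * map (\<lambda>m. m * t) ms ! j):]) =
    mat r r (\<lambda>(i, j). (if i = j then y else 0) - of_nat (d i j * ms ! j) * [:real t:])"
  using assms by (intro eq_matI) (auto simp: of_nat_poly)

lemma quartic_real_poly:
  "quartic [:real t:] [:2, 1:] = [:2, 1:] ^ 4 - [:122 * real t:] * [:2, 1:] ^ 3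
    + [:1116 * real t ^ 2:] * [:2, 1:] ^ 2
    + [:6912 * real t ^ 3:] * [:2, 1:] - [:55296 * real t ^ 4:]"
  by (rule poly_ext) (simp add: quartic_def)

text \<open>Makes the exponent in the division-free identity explicit; a monic linear factor is
  nonzero and hence cancels over a domain.\<close>

lemma cancel_linear_power:
  fixes p q :: "'a :: idom poly"
  assumes "[:c, 1:] ^ k * p = [:c, 1:] ^ n * q" "k \<le> n"
  shows "p = [:c, 1:] ^ (n - k) * q"
proof -
  have "[:c, 1:] ^ k * p = [:c, 1:] ^ k * ([:c, 1:] ^ (n - k) * q)"
    using assms by (simp add: mult.assoc[symmetric] power_add[symmetric])
  then show ?thesis by (subst (asm) mult_cancel_left) simp
qed

lemma sum_lessThan_4: "sum f {..<4 :: nat} = f 0 + f 1 + f 2 + f 3"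
  by (simp add: eval_nat_numeral)

theorem corollary4p1:
  fixes t :: nat
  assumes "t > 0"
  shows "Digraph_Component.connected (with_proj (G_graph t)) \<and>
    Digraph_Component.connected (with_proj (H_graph t)) \<and>
    distance_cospectral (G_graph t) (H_graph t) \<and>
    card (pverts (G_graph t)) = 61 * t \<and>
    card (pverts (H_graph t)) = 61 * t \<and>
    bipartite (G_graph t) \<and>
    \<not> bipartite (H_graph t) \<and>
    distance_char_poly (G_graph t) = distance_char_poly (H_graph t) \<and>
    distance_char_poly (G_graph t) =
      [:2, 1:] ^ (61 * t - 4) *
        ([:2, 1:] ^ 4 - [:122 * real t:] * [:2, 1:] ^ 3
          + [:1116 * real t ^ 2:] * [:2, 1:] ^ 2
          + [:6912 * real t ^ 3:] * [:2, 1:] - [:55296 * real t ^ 4:])"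
proof -
  interpret G: blowup_distance P4 "[t, 16 * t, 8 * t, 36 * t]" "\<lambda>i j. P4_dist ! i ! j"
    using assms by (rule blowup_distance_P4)
  interpret H: blowup_distance Paw "[4 * t, 9 * t, 16 * t, 32 * t]" "\<lambda>i j. Paw_dist ! i ! j"
    using assms by (rule blowup_distance_Paw)
  have conn: "Digraph_Component.connected (with_proj (G_graph t))"
    "Digraph_Component.connected (with_proj (H_graph t))"
    using G.connected_blowup[of 0] H.connected_blowup[of 0]
    by (simp_all add: G_graph_def H_graph_def pverts_P4_Paw)
  have card: "card (pverts (G_graph t)) = 61 * t" "card (pverts (H_graph t)) = 61 * t"
    unfolding G_graph_def H_graph_def G.card_blowup H.card_blowup
    by (simp_all add: pverts_P4_Paw sum_lessThan_4)
  have poly: "distance_char_poly (G_graph t) = [:2, 1:] ^ (61 * t - 4) * quartic [:real t:] [:2, 1:]"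
    "distance_char_poly (H_graph t) = [:2, 1:] ^ (61 * t - 4) * quartic [:real t:] [:2, 1:]"
    unfolding G_graph_def H_graph_def
  proof -
    have "map (\<lambda>m. m * t) [1, 16, 8, 36] = [t, 16 * t, 8 * t, 36 * t]"
      "map (\<lambda>m. m * t) [4, 9, 16, 32] = [4 * t, 9 * t, 16 * t, 32 * t]" by simp_all
    note det = quotient_mat_scale[of "[1, 16, 8, 36]" 4 _ _ t, unfolded this]
      quotient_mat_scale[of "[4, 9, 16, 32]" 4 _ _ t, unfolded this]
    have "det (mat 4 4 (\<lambda>(i, j). (if i = j then [:2, 1:] else 0) -
        [:real (P4_dist ! i ! j * [t, 16 * t, 8 * t, 36 * t] ! j):])) = quartic [:real t:] [:2, 1:]"
      by (subst det(1)) (simp, rule det_P4)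
    \<comment> \<open>Cancelling the fourth power needs 4 \<le> 61 t, which holds as t is
      positive.\<close>
    then show "distance_char_poly (blowup P4 [t, 16 * t, 8 * t, 36 * t]) =
        [:2, 1:] ^ (61 * t - 4) * quartic [:real t:] [:2, 1:]"
      using assms G.distance_char_poly_blowup[OF pverts_P4_Paw(1)]
      by (intro cancel_linear_power) (simp_all only: sum_lessThan_4, simp_all)
    have "det (mat 4 4 (\<lambda>(i, j). (if i = j then [:2, 1:] else 0) -
        [:real (Paw_dist ! i ! j * [4 * t, 9 * t, 16 * t, 32 * t] ! j):])) = quartic [:real t:] [:2, 1:]"
      by (subst det(2)) (simp, rule det_Paw)
    then show "distance_char_poly (blowup Paw [4 * t, 9 * t, 16 * t, 32 * t]) =
        [:2, 1:] ^ (61 * t - 4) * quartic [:real t:] [:2, 1:]"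
      using assms H.distance_char_poly_blowup[OF pverts_P4_Paw(2)]
      by (intro cancel_linear_power) (simp_all only: sum_lessThan_4, simp_all)
  qed
  have "bipartite (G_graph t)"
    unfolding bipartite_def
    \<comment> \<open>The colour classes of the path are given by parity of the part index.\<close>
    by (rule exI[of _ "{0, 2} \<times> UNIV \<inter> pverts (G_graph t)"],
        rule exI[of _ "{1, 3} \<times> UNIV \<inter> pverts (G_graph t)"])
      (auto simp: G_graph_def blowup_def P4_def ugraph_def)
  moreover have "\<not> bipartite (H_graph t)"
  proof
    assume "bipartite (H_graph t)"
    then obtain U W where UW: "U \<inter> W = {}" "parcs (H_graph t) \<subseteq> U \<times> W \<union> W \<times> U"
      by (auto simp: bipartite_def)
    \<comment> \<open>The triangle 0, 1, 2 of the paw lifts to the first vertices of its parts,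
      which are nonempty because t is positive.\<close>
    have "((0, 0), (1, 0)) \<in> parcs (H_graph t)" "((1, 0), (2, 0)) \<in> parcs (H_graph t)"
      "((0, 0), (2, 0)) \<in> parcs (H_graph t)"
      using assms by (auto simp: H_graph_def blowup_def Paw_def ugraph_def)
    with UW show False by blast
  qed
  ultimately show ?thesis
    using conn card poly
    by (simp add: distance_cospectral_def distance_spectrum_eq_proots quartic_real_poly)
qed

end
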